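(* The graphs $K_3+K_2$ and $K_3$ are $q$-equivalent for all integers $q\ge 3$.
   Context: All graphs are finite and simple. $G+H$ denotes the vertex-disjoint union of $G$ and $H$; so $K_3+K_2$ is a triangle together with a disjoint edge. For an integer $q\ge 2$, a graph $G$ is $q$-Ramsey for $H$ if every colouring of $E(G)$ with $q$ colours contains a monochromatic copy of $H$; $G$ is $q$-Ramsey-minimal for $H$ if it is $q$-Ramsey for $H$ but no proper subgraph of $G$ is; $\mathcal{M}_q(H)$ is the set of all $q$-Ramsey-minimal graphs for $H$. Two graphs $H,H'$ are $q$-equivalent if $\mathcal{M}_q(H)=\mathcal{M}_q(H')$. *)

theory Defs
  imports "HOL-Library.Ramsey" "HOL-Library.FuncSet"
begin

datatype 'v graph = Graph (verts: "'v set") (edges: "'v set set")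

text \<open>The edge sets below are sets of two-element sets of vertices; \<open>nsets V 2\<close> is the
  library's set of all two-element subsets of \<open>V\<close>.\<close>

definition simple_graph :: "'v graph \<Rightarrow> bool" where
  "simple_graph G \<longleftrightarrow> finite (verts G) \<and> edges G \<subseteq> nsets (verts G) 2"

definition subgraph :: "'v graph \<Rightarrow> 'v graph \<Rightarrow> bool" where
  "subgraph F G \<longleftrightarrow> simple_graph F \<and> simple_graph G \<and> verts F \<subseteq> verts G \<and> edges F \<subseteq> edges G"

definition graph_iso :: "'v graph \<Rightarrow> 'w graph \<Rightarrow> bool" where
  "graph_iso F H \<longleftrightarrow> (\<exists>f. bij_betw f (verts F) (verts H) \<and>
     (\<forall>u\<in>verts F. \<forall>v\<in>verts F. {u, v} \<in> edges F \<longleftrightarrow> {f u, f v} \<in> edges H))"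

definition complete_graph :: "nat \<Rightarrow> nat graph" where
  "complete_graph n = Graph {..<n} (nsets {..<n} 2)"

definition disjoint_union :: "'a graph \<Rightarrow> 'b graph \<Rightarrow> ('a + 'b) graph" where
  "disjoint_union G H =
     Graph (verts G <+> verts H) ((\<lambda>e. Inl ` e) ` edges G \<union> (\<lambda>e. Inr ` e) ` edges H)"

definition has_mono_copy :: "nat \<Rightarrow> ('v set \<Rightarrow> nat) \<Rightarrow> 'v graph \<Rightarrow> 'w graph \<Rightarrow> bool" where
  "has_mono_copy q \<chi> G H \<longleftrightarrow>
     (\<exists>F. subgraph F G \<and> graph_iso F H \<and> (\<exists>c<q. \<forall>e\<in>edges F. \<chi> e = c))"

definition q_Ramsey :: "nat \<Rightarrow> 'v graph \<Rightarrow> 'w graph \<Rightarrow> bool" where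
  "q_Ramsey q G H \<longleftrightarrow>
     simple_graph G \<and> (\<forall>\<chi> \<in> edges G \<rightarrow> {..<q}. has_mono_copy q \<chi> G H)"

definition q_Ramsey_minimal :: "nat \<Rightarrow> 'v graph \<Rightarrow> 'w graph \<Rightarrow> bool" where
  "q_Ramsey_minimal q G H \<longleftrightarrow>
     q_Ramsey q G H \<and> (\<forall>F. subgraph F G \<and> F \<noteq> G \<longrightarrow> \<not> q_Ramsey q F H)"

definition Ramsey_minimal_graphs :: "nat \<Rightarrow> 'w graph \<Rightarrow> 'v graph set" where
  "Ramsey_minimal_graphs q H = {G. q_Ramsey_minimal q G H}"

text \<open>HOL has no set of all finite graphs, so the type \<open>'v\<close> from which the vertices of the
  host graphs are drawn is an explicit parameter; any infinite type, such as
  \<^typ>\<open>nat\<close>, already contains every finite graph up to isomorphism. The vertices of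
  \<open>H\<close> and \<open>H'\<close> may come from other types.\<close>

definition q_equivalent :: "'v itself \<Rightarrow> nat \<Rightarrow> 'a graph \<Rightarrow> 'b graph \<Rightarrow> bool" where
  "q_equivalent _ q H H' \<longleftrightarrow>
     (Ramsey_minimal_graphs q H :: 'v graph set) = Ramsey_minimal_graphs q H'"

lemma simple_graph_complete_graph: "simple_graph (complete_graph n)"
  by (simp add: simple_graph_def complete_graph_def)

lemma simple_graph_disjoint_union:
  assumes "simple_graph G" "simple_graph H"
  shows "simple_graph (disjoint_union G H)"
  using assms unfolding simple_graph_def disjoint_union_def nsets_def
  by (auto simp: card_image subset_iff)

end

theory Submission
  imports Defs
begin

text \<open>Take a colouring without monochromatic \<open>K\<^sub>3 + K\<^sub>2\<close>, let \<open>K\<close> be the set of the \<open>k\<close> colours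
  containing a triangle, and choose one triangle for each of them. Every edge with a colour in \<open>K\<close>
  meets the chosen triangle of that colour, so the union \<open>S\<close> of the chosen triangles has at most
  \<open>3k\<close> vertices and all edges avoiding \<open>S\<close> have colours outside \<open>K\<close>; these keep their colour.
  The edges meeting \<open>S\<close> are recoloured from a triangle-free colouring of a complete graph on
  \<open>S\<close> and one further vertex, which represents everything outside \<open>S\<close> and is joined to \<open>S\<close> in
  colours from \<open>K\<close> only. A monochromatic triangle meeting \<open>S\<close> then has at most one vertex outside
  \<open>S\<close>, and is excluded by the template.\<close>

section \<open>Monochromatic copies as injective maps\<close>

text \<open>The inverse of an isomorphism onto \<open>H\<close> is such an \<open>f\<close>;
  conversely the image of \<open>H\<close> under \<open>f\<close> is the copy. Maps can be
  restricted along \<open>Inl\<close> and glued by \<open>case_sum\<close>, unlike subgraphs of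
  \<open>G\<close>. As a copy need not be induced, \<open>f\<close> may send non-edges to
  edges.\<close>

lemma has_mono_copy_iff_embedding:
  assumes G: "simple_graph G" and H: "simple_graph H"
  shows "has_mono_copy q \<chi> G H \<longleftrightarrow>
    (\<exists>c<q. \<exists>f. inj_on f (verts H) \<and> f ` verts H \<subseteq> verts G \<and>
       (\<forall>e\<in>edges H. f ` e \<in> edges G \<and> \<chi> (f ` e) = c))"
proof
  assume "has_mono_copy q \<chi> G H"
  then obtain F c g where F: "subgraph F G" and c: "c < q" "\<forall>e\<in>edges F. \<chi> e = c"
    and g: "bij_betw g (verts F) (verts H)"
    and adj: "\<forall>u\<in>verts F. \<forall>v\<in>verts F. {u, v} \<in> edges F \<longleftrightarrow> {g u, g v} \<in> edges H"
    unfolding has_mono_copy_def graph_iso_def by blast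
  let ?f = "inv_into (verts F) g"
  have bij: "bij_betw ?f (verts H) (verts F)"
    using g by (rule bij_betw_inv_into)
  have "?f ` e \<in> edges F" if e: "e \<in> edges H" for e
  proof -
    have "e \<in> nsets (verts H) 2"
      using e H by (auto simp: simple_graph_def)
    then obtain x y where xy: "e = {x, y}" "x \<in> verts H" "y \<in> verts H"
      by (auto simp: nsets_def card_2_iff)
    then have "g (?f x) = x" "g (?f y) = y" "?f x \<in> verts F" "?f y \<in> verts F"
      using g bij by (auto simp: bij_betw_inv_into_right bij_betw_apply)
    then show ?thesis
      using adj e xy by auto
  qed
  then show "\<exists>c<q. \<exists>f. inj_on f (verts H) \<and> f ` verts H \<subseteq> verts G \<and>
       (\<forall>e\<in>edges H. f ` e \<in> edges G \<and> \<chi> (f ` e) = c)"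
    using c F bij by (intro exI[of _ c] conjI exI[of _ ?f]) (auto simp: bij_betw_def subgraph_def)
next
  assume "\<exists>c<q. \<exists>f. inj_on f (verts H) \<and> f ` verts H \<subseteq> verts G \<and>
       (\<forall>e\<in>edges H. f ` e \<in> edges G \<and> \<chi> (f ` e) = c)"
  then obtain c f where c: "c < q" and inj: "inj_on f (verts H)" and V: "f ` verts H \<subseteq> verts G"
    and E: "\<forall>e\<in>edges H. f ` e \<in> edges G \<and> \<chi> (f ` e) = c"
    by blast
  let ?F = "Graph (f ` verts H) ((`) f ` edges H)"
  let ?g = "inv_into (verts H) f"
  have "f ` e \<in> nsets (f ` verts H) 2" if "e \<in> edges H" for e
    using that H inj inj_on_subset[OF inj, of e]
    by (auto simp: simple_graph_def nsets_def card_image subset_iff)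
  then have F: "subgraph ?F G"
    using G H V E by (auto simp: subgraph_def simple_graph_def)
  have bij: "bij_betw ?g (f ` verts H) (verts H)"
    using inj by (simp add: bij_betw_inv_into inj_on_imp_bij_betw)
  have "{f x, f y} \<in> (`) f ` edges H \<longleftrightarrow> {x, y} \<in> edges H"
    if "x \<in> verts H" "y \<in> verts H" for x y
  proof -
    have "e = {x, y}" if "e \<in> edges H" "f ` e = f ` {x, y}" for e
    proof -
      have "e \<subseteq> verts H"
        using that H by (auto simp: simple_graph_def nsets_def)
      then show ?thesis
        using inj_on_image_eq_iff[OF inj, of e "{x, y}"] that \<open>x \<in> verts H\<close> \<open>y \<in> verts H\<close> by simp
    qed
    moreover have "{f x, f y} = f ` {x, y}"
      by simp
    ultimately show ?thesis
      by (metis (no_types, lifting) image_iff)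
  qed
  then have "graph_iso ?F H"
    unfolding graph_iso_def using bij inj by (intro exI[of _ ?g]) auto
  then show "has_mono_copy q \<chi> G H"
    unfolding has_mono_copy_def using F c E by (intro exI[of _ ?F]) auto
qed

text \<open>Precompose with \<open>Inl\<close>. This yields the easy direction: Ramsey for the union
  implies Ramsey for the triangle.\<close>

lemma has_mono_copy_disjoint_unionD:
  assumes "simple_graph G" "simple_graph H" "simple_graph H'"
    and "has_mono_copy q \<chi> G (disjoint_union H H')"
  shows "has_mono_copy q \<chi> G H"
proof -
  obtain c f where "c < q" "inj_on f (verts H <+> verts H')" "f ` (verts H <+> verts H') \<subseteq> verts G"
    and E: "\<forall>e\<in>edges (disjoint_union H H'). f ` e \<in> edges G \<and> \<chi> (f ` e) = c"
    using assms(4)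
    unfolding has_mono_copy_iff_embedding[OF assms(1) simple_graph_disjoint_union[OF assms(2,3)]]
    by (auto simp: disjoint_union_def)
  moreover have "(f \<circ> Inl) ` e \<in> edges G \<and> \<chi> ((f \<circ> Inl) ` e) = c" if "e \<in> edges H" for e
    unfolding image_comp[symmetric] using E that by (auto simp: disjoint_union_def)
  ultimately show ?thesis
    unfolding has_mono_copy_iff_embedding[OF assms(1,2)]
    by (intro exI[of _ c] conjI exI[of _ "f \<circ> Inl"]) (auto simp: inj_on_def)
qed

section \<open>Monochromatic triangles\<close>

text \<open>The vertex set alone encodes a triangle, since all its pairs must be edges; any
  bijection from \<open>{..<3}\<close> onto \<open>T\<close> is then an embedding.\<close>

definition mono_triangle :: "('v set \<Rightarrow> nat) \<Rightarrow> 'v graph \<Rightarrow> nat \<Rightarrow> 'v set \<Rightarrow> bool" where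
  "mono_triangle \<chi> G c T \<longleftrightarrow> card T = 3 \<and> (\<forall>e\<in>nsets T 2. e \<in> edges G \<and> \<chi> e = c)"

lemma mono_triangle_imp_subset_verts:
  assumes "simple_graph G" "mono_triangle \<chi> G c T"
  shows "T \<subseteq> verts G"
proof
  fix x assume "x \<in> T"
  then obtain y where "y \<in> T" "y \<noteq> x"
    using assms(2) unfolding mono_triangle_def card_3_iff by blast
  then have "{x, y} \<in> edges G"
    using \<open>x \<in> T\<close> assms(2) by (auto simp: mono_triangle_def nsets_def)
  then show "x \<in> verts G"
    using assms(1) by (auto simp: simple_graph_def nsets_def)
qed

lemma has_mono_copy_triangle_iff:
  assumes "simple_graph G"
  shows "has_mono_copy q \<chi> G (complete_graph 3) \<longleftrightarrow> (\<exists>c<q. \<exists>T. mono_triangle \<chi> G c T)"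
proof
  assume "has_mono_copy q \<chi> G (complete_graph 3)"
  then obtain c f where c: "c < q" and inj: "inj_on f {..<3::nat}"
    and E: "\<forall>e\<in>nsets {..<3} 2. f ` e \<in> edges G \<and> \<chi> (f ` e) = c"
    unfolding has_mono_copy_iff_embedding[OF assms simple_graph_complete_graph]
    by (auto simp: complete_graph_def)
  have "\<exists>e'\<in>nsets {..<3} 2. e = f ` e'" if "e \<in> nsets (f ` {..<3}) 2" for e
  proof -
    have "e \<subseteq> f ` {..<3}"
      using that by (simp add: nsets_def)
    then obtain e' where "e' \<subseteq> {..<3}" "e = f ` e'"
      by (rule subset_imageE)
    moreover have "card e' = 2"
      using that calculation inj_on_subset[OF inj, of e'] by (simp add: nsets_def card_image)
    ultimately show ?thesis
      by (auto simp: nsets_def finite_subset)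
  qed
  then have "mono_triangle \<chi> G c (f ` {..<3})"
    unfolding mono_triangle_def using E inj by (auto simp: card_image)
  then show "\<exists>c<q. \<exists>T. mono_triangle \<chi> G c T"
    using c by blast
next
  assume "\<exists>c<q. \<exists>T. mono_triangle \<chi> G c T"
  then obtain c T where c: "c < q" and T: "mono_triangle \<chi> G c T"
    by blast
  obtain f where f: "bij_betw f {..<3::nat} T"
    using T by (metis bij_betw_iff_card card.infinite card_lessThan finite_lessThan
        mono_triangle_def zero_neq_numeral)
  have "f ` e \<in> nsets T 2" if "e \<in> nsets {..<3} 2" for e
    using that f inj_on_subset[of f "{..<3}" e]
    by (auto simp: nsets_def bij_betw_def card_image)
  then show "has_mono_copy q \<chi> G (complete_graph 3)"
    unfolding has_mono_copy_iff_embedding[OF assms simple_graph_complete_graph]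
    using c T f mono_triangle_imp_subset_verts[OF assms T]
    by (intro exI[of _ c] conjI exI[of _ f])
      (auto simp: bij_betw_def mono_triangle_def complete_graph_def)
qed

text \<open>Used contrapositively: without a monochromatic copy of the union, every edge in a colour
  of \<open>K\<close> meets the triangle chosen for that colour.\<close>

lemma has_mono_copy_triangle_edge:
  assumes G: "simple_graph G" and "c < q" and T: "mono_triangle \<chi> G c T"
    and e: "e \<in> edges G" "\<chi> e = c" and disj: "e \<inter> T = {}"
  shows "has_mono_copy q \<chi> G (disjoint_union (complete_graph 3) (complete_graph 2))"
proof -
  have eV: "e \<subseteq> verts G" "card e = 2"
    using G e by (auto simp: simple_graph_def nsets_def)
  obtain f where f: "bij_betw f {..<3::nat} T"
    using T by (metis bij_betw_iff_card card.infinite card_lessThan finite_lessThan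
        mono_triangle_def zero_neq_numeral)
  obtain g where g: "bij_betw g {..<2::nat} e"
    using eV by (metis bij_betw_iff_card card.infinite card_lessThan finite_lessThan
        zero_neq_numeral)
  let ?h = "case_sum f g"
  have 1: "f ` e' \<in> nsets T 2" if "e' \<in> nsets {..<3} 2" for e'
    using that f inj_on_subset[of f "{..<3}" e']
    by (auto simp: nsets_def bij_betw_def card_image)
  have 2: "g ` e' = e" if "e' \<in> nsets {..<2} 2" for e'
  proof -
    have "e' = {..<2}"
      using that by (intro card_subset_eq) (auto simp: nsets_def)
    then show ?thesis
      using g by (auto simp: bij_betw_def)
  qed
  have "f x \<noteq> g y \<and> g y \<noteq> f x" if "x < 3" "y < 2" for x y
    using that f g disj by (metis bij_betw_apply disjoint_iff lessThan_iff)
  then have "inj_on ?h ({..<3} <+> {..<2})"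
    using f g by (auto simp: inj_on_def bij_betw_def)
  moreover have "?h ` ({..<3} <+> {..<2}) \<subseteq> verts G"
    using f g eV mono_triangle_imp_subset_verts[OF G T] by (auto simp: bij_betw_def)
  ultimately show ?thesis
    unfolding has_mono_copy_iff_embedding[OF G simple_graph_disjoint_union[OF
        simple_graph_complete_graph simple_graph_complete_graph]]
    using \<open>c < q\<close> e T 1 2
    by (intro exI[of _ c] conjI exI[of _ ?h])
      (auto simp: disjoint_union_def complete_graph_def image_image mono_triangle_def)
qed

section \<open>Triangle-free template colourings\<close>

text \<open>The colours \<open>p i\<close> and \<open>Suc (p i)\<close> split the complete graph on a block of five consecutive
  numbers into two complementary pentagons.\<close>

definition pentagon_blocks :: "(nat \<Rightarrow> nat) \<Rightarrow> nat \<Rightarrow> nat \<Rightarrow> nat" where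
  "pentagon_blocks p x y =
     (if x div 5 \<noteq> y div 5 then x div 5
      else if y - x \<in> {1, 4} then p (x div 5) else Suc (p (x div 5)))"

text \<open>An edge between blocks takes the number \<open>i\<close> of the lower block. If
  \<open>x\<close> lies in a lower block than \<open>y\<close>, the edge \<open>yz\<close> has a
  colour above \<open>i\<close>, by \<open>ge\<close>. If only \<open>z\<close> leaves the block of
  \<open>x\<close>, then \<open>xy\<close> has a colour at least \<open>p i > i\<close>. Inside one
  block, neither a pentagon nor its complement has a triangle.\<close>

lemma pentagon_blocks_no_mono_triangle:
  assumes "x < y" "y < z" and ge: "\<And>j. j \<le> p j" and gt: "\<And>i. i < z div 5 \<Longrightarrow> i < p i"
    and eq: "pentagon_blocks p x y = c" "pentagon_blocks p y z = c" "pentagon_blocks p x z = c"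
  shows False
proof -
  have le: "x div 5 \<le> y div 5" "y div 5 \<le> z div 5"
    using assms(1,2) by (auto intro: div_le_mono)
  consider "x div 5 < y div 5" | "x div 5 = y div 5" "y div 5 < z div 5"
    | "x div 5 = y div 5" "y div 5 = z div 5"
    using le by linarith
  then show False
  proof cases
    case 1
    then show False
      using eq le ge[of "y div 5"] by (auto simp: pentagon_blocks_def split: if_splits)
  next
    case 2
    then show False
      using eq gt[of "x div 5"] by (auto simp: pentagon_blocks_def split: if_splits)
  next
    case 3
    then have "z - x \<le> 4"
      using div_mult_mod_eq[of x 5] div_mult_mod_eq[of z 5] mod_less_divisor[of 5 z] by linarith
    then show False
      using eq 3 assms(1,2) by (auto simp: pentagon_blocks_def split: if_splits) linarith
  qed
qed

text \<open>The vertex \<open>N\<close> represents everything outside the covering set. For \<open>k \<le> 2\<close> it lies in a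
  block of its own and only block \<open>0\<close> has inner edges, so that three colours suffice; for
  \<open>k \<ge> 3\<close> it is the fifth vertex of the last block, and \<open>3k + 1 \<le> 5(k - 1)\<close> lets the first \<open>k\<close>
  colours suffice.\<close>

lemma template_colouring:
  fixes k q :: nat
  assumes "3 \<le> q" "0 < k" "k \<le> q"
  obtains N and d :: "nat set \<Rightarrow> nat" where "3 * k \<le> N"
    and "\<And>x y. x < y \<Longrightarrow> y < 3 * k \<or> x < 3 * k \<and> y = N \<Longrightarrow> d {x, y} < q"
    and "\<And>x. x < 3 * k \<Longrightarrow> d {x, N} < k"
    and "\<And>x y z. x < y \<Longrightarrow> y < z \<Longrightarrow> y < 3 * k \<Longrightarrow> z < 3 * k \<or> z = N \<Longrightarrow>
           \<not> (d {x, y} = d {y, z} \<and> d {x, z} = d {y, z})"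
proof -
  \<comment> \<open>For \<open>k \<ge> 3\<close> the last block \<open>k - 2\<close> reuses its own
    number as an inner colour: no edge leads from it to a later block, and its colours
    \<open>k - 2\<close> and \<open>k - 1\<close> stay below \<open>k\<close>.\<close>
  define p where "p i = (if k \<le> 2 then Suc i else if i \<le> k - 3 then Suc i else i)" for i
  define N where "N = (if k \<le> 2 then 5 * k else 5 * (k - 2) + 4)"
  \<comment> \<open>Edges are unordered, while \<open>pentagon_blocks\<close> expects the smaller
    endpoint first.\<close>
  define d where "d e = pentagon_blocks p (Min e) (Max e)" for e :: "nat set"
  have d: "d {x, y} = pentagon_blocks p x y" if "x < y" for x y
    using that by (simp add: d_def min_def max_def)
  have N: "3 * k \<le> N"
    unfolding N_def by auto
  have Ndiv: "N div 5 = (if k \<le> 2 then k else k - 2)"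
    unfolding N_def by auto
  have small: "x div 5 < k" if "x < 3 * k" for x
    using that by (intro less_mult_imp_div_less) simp
  have large: "x div 5 \<le> k - 2" if "\<not> k \<le> 2" "x \<le> N" for x
    using that Ndiv div_le_mono[of x N 5] by simp
  \<comment> \<open>For \<open>k \<ge> 3\<close> the bound \<open>k\<close> serves edges at
    \<open>N\<close> as well. For \<open>k \<le> 2\<close> inner edges may need colour 2, so edges
    at \<open>N\<close> get their bound separately.\<close>
  have col: "pentagon_blocks p x y < (if k \<le> 2 then q else k)"
    if "x < y" "y < 3 * k \<or> x < 3 * k \<and> y = N" for x y
  proof (cases "k \<le> 2")
    case True
    have "x div 5 < k"
      using small[of x] that by auto
    \<comment> \<open>Here \<open>N\<close> is alone in its block and
      \<open>y < 3 * k \<le> 6\<close>, so \<open>x \<le> 4\<close>; the inner colours are then 1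
      and 2, both below \<open>q\<close>.\<close>
    moreover have "x div 5 = 0" if "x div 5 = y div 5"
    proof -
      have "y < 3 * k"
        using \<open>y < 3 * k \<or> x < 3 * k \<and> y = N\<close> True Ndiv that calculation by auto
      then show ?thesis
        using \<open>x < y\<close> True by simp
    qed
    ultimately show ?thesis
      using True assms by (auto simp: pentagon_blocks_def p_def)
  next
    case False
    then have "x div 5 \<le> k - 2"
      using large[of x] that N by auto
    then show ?thesis
      using False by (auto simp: pentagon_blocks_def p_def)
  qed
  show ?thesis
  proof
    show "3 * k \<le> N"
      by (rule N)
    show "d {x, y} < q" if "x < y" "y < 3 * k \<or> x < 3 * k \<and> y = N" for x y
      using col[OF that] assms that by (auto simp: d split: if_splits)
    show "d {x, N} < k" if "x < 3 * k" for x
    proof (cases "k \<le> 2")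
      case True
      then show ?thesis
        using small[OF that] N that Ndiv by (auto simp: d pentagon_blocks_def)
    next
      case False
      then show ?thesis
        using col[of x N] N that by (auto simp: d)
    qed
    show "\<not> (d {x, y} = d {y, z} \<and> d {x, z} = d {y, z})"
      if "x < y" "y < z" "y < 3 * k" "z < 3 * k \<or> z = N" for x y z
    proof -
      have "z \<le> N"
        using that N by auto
      then have "k \<le> 2 \<or> i < k - 2" if "i < z div 5" for i
        using that large[of z] by linarith
      then have "i < p i" if "i < z div 5" for i
        using that by (fastforce simp: p_def)
      moreover have "j \<le> p j" for j
        by (auto simp: p_def)
      ultimately show ?thesis
        using pentagon_blocks_no_mono_triangle[OF that(1,2), of p] that by (auto simp: d)
    qed
  qed
qed

section \<open>Recolouring the host graph\<close>

text \<open>Renames colours so that the template colours below \<open>k\<close> become those of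
  \<open>K\<close>; a bijection onto \<open>K\<close> is glued to one between the complements, which
  have equal size.\<close>

lemma obtain_initial_bij:
  fixes K :: "nat set"
  assumes "K \<subseteq> {..<q}"
  obtains h where "bij_betw h {..<q} {..<q}" "h ` {..<card K} = K"
proof -
  have fin: "finite K" and le: "card K \<le> q"
    using assms card_mono[of "{..<q}" K] by (auto intro: finite_subset)
  obtain f where f: "bij_betw f {..<card K} K"
    using fin by (metis bij_betw_iff_card card_lessThan finite_lessThan)
  have "card {card K..<q} = card ({..<q} - K)"
    using assms fin by (simp add: card_Diff_subset)
  then obtain g where g: "bij_betw g {card K..<q} ({..<q} - K)"
    by (metis bij_betw_iff_card finite_Diff finite_atLeastLessThan finite_lessThan)
  let ?h = "\<lambda>x. if x < card K then f x else g x"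
  have 1: "bij_betw ?h {..<card K} K"
    using f by (rule bij_betw_cong[THEN iffD1, rotated]) auto
  moreover have "bij_betw ?h {card K..<q} ({..<q} - K)"
    using g by (rule bij_betw_cong[THEN iffD1, rotated]) auto
  ultimately have "bij_betw ?h ({..<card K} \<union> {card K..<q}) (K \<union> ({..<q} - K))"
    by (rule bij_betw_combine) auto
  moreover have "{..<card K} \<union> {card K..<q} = {..<q}" "K \<union> ({..<q} - K) = {..<q}"
    using le assms by auto
  ultimately show ?thesis
    using that[of ?h] 1 by (simp add: bij_betw_def)
qed

lemma recolour_without_mono_triangle:
  assumes G: "simple_graph G" and q: "3 \<le> q" and \<chi>: "\<chi> \<in> edges G \<rightarrow> {..<q}"
    and no: "\<not> has_mono_copy q \<chi> G (disjoint_union (complete_graph 3) (complete_graph 2))"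
  obtains \<chi>' where "\<chi>' \<in> edges G \<rightarrow> {..<q}" "\<not> has_mono_copy q \<chi>' G (complete_graph 3)"
\<comment> \<open>Without a monochromatic triangle \<chi> itself serves; otherwise \<open>K\<close>
  is nonempty, as the template requires.\<close>
proof (cases "has_mono_copy q \<chi> G (complete_graph 3)")
  case False
  then show ?thesis
    using that \<chi> by blast
next
  case True
  define K where "K = {c. c < q \<and> (\<exists>T. mono_triangle \<chi> G c T)}"
  define k where "k = card K"
  have Kq: "K \<subseteq> {..<q}"
    by (auto simp: K_def)
  have k: "0 < k" "k \<le> q"
    using True G Kq card_mono[OF _ Kq] finite_subset[OF Kq]
    by (auto simp: k_def K_def has_mono_copy_triangle_iff card_gt_0_iff)
  obtain h where h: "bij_betw h {..<q} {..<q}" "h ` {..<k} = K"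
    using obtain_initial_bij[OF Kq] unfolding k_def by blast
  have "\<forall>c\<in>K. \<exists>T. mono_triangle \<chi> G c T"
    by (simp add: K_def)
  then obtain T where T: "\<And>c. c \<in> K \<Longrightarrow> mono_triangle \<chi> G c (T c)"
    by metis
  define S where "S = (\<Union>c\<in>K. T c)"
  have outside: "\<chi> e \<notin> K" if "e \<in> edges G" "e \<inter> S = {}" for e
  proof
    assume "\<chi> e \<in> K"
    then show False
      using has_mono_copy_triangle_edge[OF G _ T \<open>e \<in> edges G\<close>, of "\<chi> e" q] no Kq that
      by (auto simp: S_def)
  qed
  have finK: "finite K"
    using Kq finite_subset by blast
  have finS: "finite S"
    using finK T unfolding S_def mono_triangle_def
    by (intro finite_UN_I) (auto intro: card_ge_0_finite)
  have "card S \<le> (\<Sum>c\<in>K. card (T c))"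
    unfolding S_def using finK by (rule card_UN_le)
  also have "\<dots> = 3 * k"
    using T by (simp add: mono_triangle_def k_def)
  finally have cardS: "card S \<le> 3 * k" .
  obtain g0 where g0: "bij_betw g0 S {..<card S}"
    using finS by (metis bij_betw_iff_card card_lessThan finite_lessThan)
  obtain N and d :: "nat set \<Rightarrow> nat" where N: "3 * k \<le> N"
    and d_less: "\<And>x y. x < y \<Longrightarrow> y < 3 * k \<or> x < 3 * k \<and> y = N \<Longrightarrow> d {x, y} < q"
    and d_N: "\<And>x. x < 3 * k \<Longrightarrow> d {x, N} < k"
    and d_tri: "\<And>x y z. x < y \<Longrightarrow> y < z \<Longrightarrow> y < 3 * k \<Longrightarrow> z < 3 * k \<or> z = N \<Longrightarrow>
           \<not> (d {x, y} = d {y, z} \<and> d {x, z} = d {y, z})"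
    by (rule template_colouring[OF q k]) (rule that)
  \<comment> \<open>Everything outside \<open>S\<close> collapses to \<open>N\<close>. Only pairs
    avoiding \<open>S\<close> are identified, and these never consult the template.\<close>
  define g where "g v = (if v \<in> S then g0 v else N)" for v
  have gS: "g v < 3 * k" if "v \<in> S" for v
    using that bij_betw_apply[OF g0 that] cardS by (simp add: g_def)
  have gN: "g v = N" if "v \<notin> S" for v
    using that by (simp add: g_def)
  have g_neq: "g u \<noteq> g v" if "u \<noteq> v" "u \<in> S \<or> v \<in> S" for u v
  proof (cases "u \<in> S \<and> v \<in> S")
    case True
    then show ?thesis
      using that g0 by (auto simp: g_def bij_betw_def inj_on_def)
  next
    case False
    then show ?thesis
      using that gS gN N by (metis linorder_not_le)
  qed
  define \<chi>' where "\<chi>' e = (if e \<inter> S = {} then \<chi> e else h (d (g ` e)))" for e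
  have d_g: "d {g u, g v} < q" if "u \<noteq> v" "u \<in> S \<or> v \<in> S" for u v
  proof -
    have "g u < g v \<or> g v < g u"
      using g_neq[OF that] by linarith
    then show ?thesis
      using d_less[of "g u" "g v"] d_less[of "g v" "g u"] gS[of u] gS[of v] gN[of u] gN[of v] that N
      by (cases "u \<in> S"; cases "v \<in> S") (auto simp: insert_commute)
  qed
  have "\<chi>' e < q" if "e \<in> edges G" for e
  proof (cases "e \<inter> S = {}")
    case True
    then show ?thesis
      using \<chi> that by (auto simp: \<chi>'_def)
  next
    case False
    have "card e = 2"
      using G that by (auto simp: simple_graph_def nsets_def)
    then obtain u v where "e = {u, v}" "u \<noteq> v"
      by (auto simp: card_2_iff)
    moreover have "d (g ` e) < q"
      using d_g[of u v] calculation False by auto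
    ultimately show ?thesis
      using False h(1) by (auto simp: \<chi>'_def bij_betw_def)
  qed
  moreover have "\<not> has_mono_copy q \<chi>' G (complete_graph 3)"
  proof
    assume "has_mono_copy q \<chi>' G (complete_graph 3)"
    then obtain c A where c: "c < q" and A: "mono_triangle \<chi>' G c A"
      using has_mono_copy_triangle_iff[OF G] by blast
    have edge: "{u, v} \<in> edges G" "\<chi>' {u, v} = c" if "u \<in> A" "v \<in> A" "u \<noteq> v" for u v
      using A that by (auto simp: mono_triangle_def nsets_def)
    have cS: "c = h (d {g u, g v})" if "u \<in> A" "v \<in> A" "u \<noteq> v" "u \<in> S \<or> v \<in> S" for u v
      using edge[OF that(1-3)] that by (auto simp: \<chi>'_def)
    show False
    proof (cases "\<exists>u\<in>A. \<exists>v\<in>A. u \<noteq> v \<and> u \<notin> S \<and> v \<notin> S")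
      case True
      then obtain u v where uv: "u \<in> A" "v \<in> A" "u \<noteq> v" "u \<notin> S" "v \<notin> S"
        by blast
      \<comment> \<open>The edge \<open>uv\<close> kept its old colour. If \<open>A\<close> avoids
        \<open>S\<close>, it was already a triangle of colour \<open>c\<close>, so \<open>c\<close>
        lies in \<open>K\<close>; if it meets \<open>S\<close> in \<open>w\<close>, the edge
        \<open>wu\<close> has a colour in \<open>K\<close> by \<open>d_N\<close>.\<close>
      then have "c \<notin> K"
        using edge[OF uv(1-3)] outside[of "{u, v}"] by (simp add: \<chi>'_def)
      show False
      proof (cases "A \<inter> S = {}")
        case True
        have "\<chi>' e = \<chi> e" if "e \<in> nsets A 2" for e
          using that True by (auto simp: \<chi>'_def nsets_def)
        then have "mono_triangle \<chi> G c A"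
          using A by (auto simp: mono_triangle_def)
        then show False
          using c \<open>c \<notin> K\<close> by (auto simp: K_def)
      next
        case False
        then obtain w where "w \<in> A" "w \<in> S"
          by blast
        then have "c = h (d {g w, N})"
          using cS[of w u] uv gN by metis
        then show False
          using \<open>c \<notin> K\<close> h(2) d_N[OF gS[OF \<open>w \<in> S\<close>]] by blast
      qed
    next
      case False
      then have two: "u \<in> S \<or> v \<in> S" if "u \<in> A" "v \<in> A" "u \<noteq> v" for u v
        using that by blast
      \<comment> \<open>Template colours are below \<open>q\<close>, where \<open>h\<close> is
        injective, so equal new colours come from equal template colours.\<close>
      have same: "d {g u, g v} = d {g u', g v'}"
        if "u \<in> A" "v \<in> A" "u \<noteq> v" "u' \<in> A" "v' \<in> A" "u' \<noteq> v'" for u v u' v'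
        using cS[of u v] cS[of u' v'] two[of u v] two[of u' v'] d_g[of u v] d_g[of u' v'] h(1) that
        by (auto simp: bij_betw_def inj_on_def)
      have inj: "inj_on g A"
        using g_neq two by (auto simp: inj_on_def)
      obtain u v w where uvw: "u \<in> A" "v \<in> A" "w \<in> A" "g u < g v" "g v < g w"
      proof -
        have "finite (g ` A)" "card (g ` A) = 3"
          using A inj by (auto simp: mono_triangle_def card_image intro: card_ge_0_finite)
        then obtain x y z where "g ` A = {x, y, z}" "x < y" "y < z"
          by (auto simp: card_3_iff) (metis insert_commute linorder_less_linear)
        then show ?thesis
          using that by (metis image_iff insertCI)
      qed
      \<comment> \<open>\<open>N\<close> bounds all values of \<open>g\<close> from above, so a
        vertex mapped to \<open>N\<close> cannot be the middle one.\<close>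
      have "v \<in> S"
      proof (rule ccontr)
        assume "v \<notin> S"
        then have "w \<in> S" "g v = N"
          using two[of v w] uvw gN by auto
        then show False
          using gS[of w] uvw(5) N by linarith
      qed
      moreover have "g w < 3 * k \<or> g w = N"
        using gS gN by blast
      moreover have "u \<noteq> v" "v \<noteq> w" "u \<noteq> w"
        using uvw(4,5) by auto
      ultimately show False
        using d_tri[OF uvw(4,5)] gS[of v] same[of u v v w] same[of u w v w] uvw by auto
    qed
  qed
  ultimately show ?thesis
    using that by blast
qed

theorem theorem1p7:
  fixes q :: nat
  assumes "q \<ge> 3"
  shows "q_equivalent TYPE('v) q
           (disjoint_union (complete_graph 3) (complete_graph 2)) (complete_graph 3)"
proof -
  \<comment> \<open>Minimality refers to the target graph only through \<open>q_Ramsey\<close>, so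
    agreement of the two Ramsey properties on every \<open>G\<close> suffices.\<close>
  have "q_Ramsey q G (disjoint_union (complete_graph 3) (complete_graph 2))
      \<longleftrightarrow> q_Ramsey q G (complete_graph 3)" for G :: "'v graph"
    unfolding q_Ramsey_def
    using recolour_without_mono_triangle[OF _ assms, of G]
      has_mono_copy_disjoint_unionD[OF _ simple_graph_complete_graph simple_graph_complete_graph]
    by metis
  then show ?thesis
    by (simp add: q_equivalent_def Ramsey_minimal_graphs_def q_Ramsey_minimal_def)
qed

end
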